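(* Let $\mathcal{E}$ be an error basis on $\mathfrak{H}=\mathbb{C}^q$, let $\mathbf{u}=(u_1,\dots,u_k)$ be indeterminates, and let $\widetilde{\mathrm{wt}}:\mathcal{E}^2\to\mathbb{Z}^k_{\ge0}\cup\{\bot\}$ be a scalar weight function for which there is an algebraic map $\Phi(\mathbf{u})=(\Phi_1(\mathbf{u}),\dots,\Phi_k(\mathbf{u}))$ with $$\Phi(\mathbf{u})^{\widetilde{\mathrm{wt}}(D,D')}=\frac{1}{q^2}\sum_{E,E'\in\mathcal{E}}\operatorname{Tr}(E^\dagger DE'(D')^\dagger)\,\mathbf{u}^{\widetilde{\mathrm{wt}}(E,E')}\quad\text{for all }D,D'\in\mathcal{E}.$$ Let $J=\{j_1,\dots,j_m\}\subseteq\{1,\dots,n\}$ and define the enumerators, for Hermitian $M_1,M_2$ on $\mathfrak{H}^{\otimes n}$, $$\mathbf{A}^{(J)}(\mathbf{u};M_1,M_2)=\sum_{E,E'\in\mathcal{E}^n}\operatorname{Tr}(E^\dagger M_1)\operatorname{Tr}(E'M_2)\Big(\prod_{k\notin J}\mathbf{u}^{\widetilde{\mathrm{wt}}(E_k,E_k')}\Big)e_{E_{j_1},E'_{j_1}}\cdots e_{E_{j_m},E'_{j_m}},$$ $$\mathbf{B}^{(J)}(\mathbf{u};M_1,M_2)=\sum_{E,E'\in\mathcal{E}^n}\operatorname{Tr}(E^\dagger M_1E'M_2)\Big(\prod_{k\notin J}\mathbf{u}^{\widetilde{\mathrm{wt}}(E_k,E_k')}\Big)e_{E_{j_1},E'_{j_1}}\cdots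 e_{E_{j_m},E'_{j_m}}.$$ Then $$\mathbf{B}^{(J)}(\mathbf{u};M_1,M_2)=\Psi\left[\mathbf{A}^{(J)}(\Phi(\mathbf{u});M_1,M_2)\right],$$ where $\Psi$ is the linear map with $\Psi(e_{E,E'})=\frac{1}{q^{2m}}\sum_{F,F'\in\mathcal{E}^m}\operatorname{Tr}(F^\dagger EF'(E')^\dagger)\,e_{F,F'}$ for $E,E'\in\mathcal{E}^m$.
   Context: An error basis on $\mathfrak{H}=\mathbb{C}^q$ is a set $\mathcal{E}$ of unitary operators containing $I$ that is a basis of $L(\mathfrak{H})$ (so $|\mathcal{E}|=q^2$), with $\operatorname{Tr}(EF^\dagger)=0$ for $E\neq F$, and such that $EF=\omega(E,F)FE$ for all $E,F\in\mathcal{E}$, with scalars $\omega(E,F)\in\mathbb{C}$ satisfying $\omega(E,F)^r=1$ for some fixed $r$. Put $\mathcal{E}^n=\{E_1\otimes\cdots\otimes E_n: E_i\in\mathcal{E}\}$. A weight function is a function $\mathrm{wt}:\mathcal{E}^2\to\mathbb{Z}_{\ge0}^k\cup\{\bot\}$; it is scalar if $\mathrm{wt}(E,E')=\bot$ whenever $E\ne E'$. For a $k$-tuple $\mathbf{v}$ of commuting quantities, $\mathbf{v}^t=\prod_i v_i^{t_i}$ for $t\in\mathbb{Z}_{\ge0}^k$, and $\mathbf{v}^\bot=0$. An algebraic map $\Phi$ is one whose components are algebraic functions of $\mathbf{u}$ (elements of a fixed algebraic closure of $\mathbb{C}(\mathbf{u})$, for instance polynomials). For each leg $j_i\in J$ there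 is a separate set of formal variables $\{e_{E,E'}\}_{E,E'\in\mathcal{E}}$; a product $e_{E_{j_1},E'_{j_1}}\cdots e_{E_{j_m},E'_{j_m}}$ (one variable from each set, in leg order) is identified with the basis element $e_{G,G'}$, $G=E_{j_1}\otimes\cdots\otimes E_{j_m}$, $G'=E'_{j_1}\otimes\cdots\otimes E'_{j_m}$, of $V^{\otimes m}$, where $V$ is the complex vector space with basis $\{e_{E,E'}\}_{E,E'\in\mathcal{E}}$. $\Psi$ acts on $V^{\otimes m}$ and is extended linearly over the coefficient functions in $\mathbf{u}$; $\mathbf{A}^{(J)}(\Phi(\mathbf{u});\cdot)$ is obtained by substituting $u_i\mapsto\Phi_i(\mathbf{u})$ in the coefficients only. *)

theory Defs
  imports
    "Jordan_Normal_Form.Schur_Decomposition"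
    "Jordan_Normal_Form.VS_Connect"
    "HOL-Library.FuncSet"
    "HOL-Library.Poly_Mapping"
    "HOL-Computational_Algebra.Polynomial_Factorial"
    "HOL-Algebra.Algebraic_Closure_Type"
begin

type_synonym cmat = "complex mat"

subsection \<open>Operators and tensor products\<close>

definition mtrace :: "cmat \<Rightarrow> complex" where
  "mtrace A = (\<Sum>i<dim_row A. A $$ (i, i))"

text \<open>The Kronecker product: the standard basis of a tensor product is ordered
  lexicographically, the first factor being the most significant one.\<close>

definition kron :: "cmat \<Rightarrow> cmat \<Rightarrow> cmat" (infixr \<open>\<otimes>\<^sub>k\<close> 70) where
  "A \<otimes>\<^sub>k B = mat (dim_row A * dim_row B) (dim_col A * dim_col B)
     (\<lambda>(i, j). A $$ (i div dim_row B, j div dim_col B) * B $$ (i mod dim_row B, j mod dim_col B))"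

definition tensor :: "cmat list \<Rightarrow> cmat" where
  "tensor As = foldr (\<otimes>\<^sub>k) As (1\<^sub>m 1)"

definition is_unitary :: "nat \<Rightarrow> cmat \<Rightarrow> bool" where
  "is_unitary q U \<longleftrightarrow> U \<in> carrier_mat q q \<and>
     U * mat_adjoint U = 1\<^sub>m q \<and> mat_adjoint U * U = 1\<^sub>m q"

definition is_hermitian :: "nat \<Rightarrow> cmat \<Rightarrow> bool" where
  "is_hermitian d M \<longleftrightarrow> M \<in> carrier_mat d d \<and> mat_adjoint M = M"

subsection \<open>Error bases\<close>

definition error_basis :: "nat \<Rightarrow> cmat set \<Rightarrow> bool" where
  "error_basis q \<E> \<longleftrightarrow>
     (\<forall>E\<in>\<E>. is_unitary q E) \<and>
     1\<^sub>m q \<in> \<E> \<and>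
     vectorspace.basis class_ring (module_mat TYPE(complex) q q) \<E> \<and>
     (\<forall>E\<in>\<E>. \<forall>F\<in>\<E>. E \<noteq> F \<longrightarrow> mtrace (E * mat_adjoint F) = 0) \<and>
     (\<exists>(r::nat) \<omega>. r \<ge> 1 \<and> (\<forall>E\<in>\<E>. \<forall>F\<in>\<E>. E * F = \<omega> E F \<cdot>\<^sub>m (F * E) \<and> \<omega> E F ^ r = 1))"

definition error_tensors :: "cmat set \<Rightarrow> nat \<Rightarrow> cmat set" where
  "error_tensors \<E> m = {tensor Es | Es. length Es = m \<and> set Es \<subseteq> \<E>}"

subsection \<open>Algebraic functions and weights\<close>

text \<open>The indeterminates are indexed by a finite type \<open>'k\<close>, whose cardinality is the number
  of variables.  Polynomials are finitely supported functions on exponent vectors, and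
  algebraic functions are the elements of the algebraic closure of the field of
  rational functions.  (The order on \<open>'k\<close> only serves to make the polynomial ring an instance
  of the class of integral domains.)\<close>

type_synonym 'k algfun = "(('k \<Rightarrow>\<^sub>0 nat) \<Rightarrow>\<^sub>0 complex) fract alg_closure"

definition const_fun :: "complex \<Rightarrow> ('k::{finite,linorder}) algfun" where
  "const_fun c = to_ac (to_fract (Poly_Mapping.single 0 c))"

definition indet :: "'k \<Rightarrow> ('k::{finite,linorder}) algfun" where
  "indet i = to_ac (to_fract (Poly_Mapping.single (Poly_Mapping.single i 1) 1))"

text \<open>\<open>None\<close> is the weight \<open>\<bottom>\<close>.\<close>

type_synonym 'k weight = "cmat \<Rightarrow> cmat \<Rightarrow> ('k \<Rightarrow> nat) option"

definition scalar_weight :: "cmat set \<Rightarrow> 'k weight \<Rightarrow> bool" where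
  "scalar_weight \<E> wt \<longleftrightarrow> (\<forall>E\<in>\<E>. \<forall>E'\<in>\<E>. E \<noteq> E' \<longrightarrow> wt E E' = None)"

definition vpow :: "('k::finite \<Rightarrow> 'a::comm_semiring_1) \<Rightarrow> ('k \<Rightarrow> nat) option \<Rightarrow> 'a" where
  "vpow v t = (case t of None \<Rightarrow> 0 | Some t \<Rightarrow> \<Prod>i\<in>UNIV. v i ^ t i)"

subsection \<open>Tensor enumerators\<close>

text \<open>The free module over the algebraic functions on symbols \<open>e\<^bsub>G,G'\<^esub>\<close>, encoded as
  \<open>Poly_Mapping.single (G, G') 1\<close>.  The \<open>m\<close>-th tensor power of \<open>V\<close>, with coefficients
  extended, is the submodule on the symbols with \<open>G, G'\<close> in \<open>error_tensors \<E> m\<close>;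
  the enumerators take values in it and \<open>Psi\<close> maps it into itself.\<close>

type_synonym 'k tensor_space = "(cmat \<times> cmat) \<Rightarrow>\<^sub>0 'k algfun"

text \<open>The legs are numbered from 1 to \<open>n\<close> and \<open>js\<close> lists the legs in \<open>J\<close>.
  An element of the \<open>n\<close>-th power of \<open>\<E>\<close> is given by the family of its tensor factors,
  which it determines (see \<open>error_basis_tensor_inj\<close> below).
  Evaluation at \<open>v = indet\<close> gives the enumerators in the indeterminates, and evaluation
  at \<open>v = \<Phi>\<close> substitutes \<open>\<Phi>\<close> into their coefficients.\<close>

definition enum_A ::
  "cmat set \<Rightarrow> nat \<Rightarrow> nat list \<Rightarrow> ('k::{finite,linorder}) weight \<Rightarrow>
   ('k \<Rightarrow> 'k algfun) \<Rightarrow> cmat \<Rightarrow> cmat \<Rightarrow> 'k tensor_space" where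
  "enum_A \<E> n js wt v M\<^sub>1 M\<^sub>2 =
     (\<Sum>E \<in> {1..n} \<rightarrow>\<^sub>E \<E>. \<Sum>E' \<in> {1..n} \<rightarrow>\<^sub>E \<E>.
        Poly_Mapping.single (tensor (map E js), tensor (map E' js))
          (const_fun (mtrace (mat_adjoint (tensor (map E [1..<Suc n])) * M\<^sub>1)) *
           const_fun (mtrace (tensor (map E' [1..<Suc n]) * M\<^sub>2)) *
           (\<Prod>k \<in> {1..n} - set js. vpow v (wt (E k) (E' k)))))"

definition enum_B ::
  "cmat set \<Rightarrow> nat \<Rightarrow> nat list \<Rightarrow> ('k::{finite,linorder}) weight \<Rightarrow>
   ('k \<Rightarrow> 'k algfun) \<Rightarrow> cmat \<Rightarrow> cmat \<Rightarrow> 'k tensor_space" where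
  "enum_B \<E> n js wt v M\<^sub>1 M\<^sub>2 =
     (\<Sum>E \<in> {1..n} \<rightarrow>\<^sub>E \<E>. \<Sum>E' \<in> {1..n} \<rightarrow>\<^sub>E \<E>.
        Poly_Mapping.single (tensor (map E js), tensor (map E' js))
          (const_fun (mtrace (mat_adjoint (tensor (map E [1..<Suc n])) * M\<^sub>1 *
                              tensor (map E' [1..<Suc n]) * M\<^sub>2)) *
           (\<Prod>k \<in> {1..n} - set js. vpow v (wt (E k) (E' k)))))"

subsection \<open>The MacWilliams transform\<close>

definition scale :: "('k::{finite,linorder}) algfun \<Rightarrow> 'k tensor_space \<Rightarrow> 'k tensor_space" where
  "scale c x = Poly_Mapping.map ((*) c) x"

definition Psi_basis ::
  "nat \<Rightarrow> cmat set \<Rightarrow> nat \<Rightarrow> cmat \<Rightarrow> cmat \<Rightarrow> ('k::{finite,linorder}) tensor_space" where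
  "Psi_basis q \<E> m E E' =
     scale (const_fun (1 / of_nat q ^ (2 * m)))
       (\<Sum>F\<in>error_tensors \<E> m. \<Sum>F'\<in>error_tensors \<E> m.
          Poly_Mapping.single (F, F')
            (const_fun (mtrace (mat_adjoint F * E * F' * mat_adjoint E'))))"

definition Psi ::
  "nat \<Rightarrow> cmat set \<Rightarrow> nat \<Rightarrow> 'k tensor_space \<Rightarrow> ('k::{finite,linorder}) tensor_space" where
  "Psi q \<E> m x =
     (\<Sum>E\<in>error_tensors \<E> m. \<Sum>E'\<in>error_tensors \<E> m.
        scale (Poly_Mapping.lookup x (E, E')) (Psi_basis q \<E> m E E'))"

subsection \<open>Consistency of the encoding\<close>

lemma lookup_scale [simp]: "Poly_Mapping.lookup (scale c x) k = c * Poly_Mapping.lookup x k"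
  by (simp add: scale_def map.rep_eq when_def)

lemma scale_add_right: "scale c (x + y) = scale c x + scale c y"
  by (rule poly_mapping_eqI) (simp add: lookup_add distrib_left)

lemma scale_add_left: "scale (a + b) z = scale a z + scale b z"
  by (rule poly_mapping_eqI) (simp add: lookup_add distrib_right)

lemma scale_scale: "scale a (scale b y) = scale (a * b) y"
  by (rule poly_mapping_eqI) (simp add: mult.assoc)

lemma scale_sum: "scale c (sum f A) = (\<Sum>a\<in>A. scale c (f a))"
proof (induction A rule: infinite_finite_induct)
  case (insert a A)
  then show ?case by (simp add: scale_add_right)
qed (auto intro: poly_mapping_eqI)

lemma Psi_scale: "Psi q \<E> m (scale c x) = scale c (Psi q \<E> m x)"
  unfolding Psi_def scale_sum scale_scale lookup_scale ..

lemma Psi_add: "Psi q \<E> m (x + y) = Psi q \<E> m x + Psi q \<E> m y"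
  unfolding Psi_def lookup_add scale_add_left sum.distrib ..

lemma Psi_single:
  assumes "finite \<E>" "E \<in> error_tensors \<E> m" "E' \<in> error_tensors \<E> m"
  shows "Psi q \<E> m (Poly_Mapping.single (E, E') 1) = Psi_basis q \<E> m E E'"
proof -
  have "error_tensors \<E> m = tensor ` {Es. set Es \<subseteq> \<E> \<and> length Es = m}"
    by (auto simp: error_tensors_def)
  then have fin: "finite (error_tensors \<E> m)"
    using finite_lists_length_eq[OF assms(1)] by simp
  have 1: "scale 1 z = z" for z :: "'a tensor_space"
    by (rule poly_mapping_eqI) simp
  have 0: "scale 0 z = 0" for z :: "'a tensor_space"
    by (rule poly_mapping_eqI) simp
  have *: "scale (Poly_Mapping.lookup (Poly_Mapping.single (E, E') 1) (G, G')) (Psi_basis q \<E> m G G')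
        = (if G' = E' then if G = E then Psi_basis q \<E> m G G' else 0 else (0 :: 'a tensor_space))" for G G'
    by (auto simp: lookup_single when_def 0 1)
  have "Psi q \<E> m (Poly_Mapping.single (E, E') 1) =
    (\<Sum>G\<in>error_tensors \<E> m. if G = E then Psi_basis q \<E> m G E' else (0 :: 'a tensor_space))"
    unfolding Psi_def * using fin assms(3) by (simp add: sum.delta)
  then show ?thesis
    using fin assms(2) by (simp add: sum.delta)
qed

lemma dim_kron [simp]:
  "dim_row (A \<otimes>\<^sub>k B) = dim_row A * dim_row B" "dim_col (A \<otimes>\<^sub>k B) = dim_col A * dim_col B"
  by (simp_all add: kron_def)

lemma kron_entry:
  assumes "i < dim_row A" "j < dim_col A" "i' < dim_row B" "j' < dim_col B"
  shows "(A \<otimes>\<^sub>k B) $$ (i * dim_row B + i', j * dim_col B + j') = A $$ (i, j) * B $$ (i', j')"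
proof -
  have lt: "a * c + b < d * c" if "a < d" "b < c" for a b c d :: nat
  proof -
    have "a * c + b < (a + 1) * c" using that(2) by simp
    also have "\<dots> \<le> d * c" using that(1) by (intro mult_right_mono) auto
    finally show ?thesis .
  qed
  show ?thesis
    using assms lt[OF assms(1,3)] lt[OF assms(2,4)] by (simp add: kron_def)
qed

lemma tensor_carrier:
  assumes "set Es \<subseteq> carrier_mat q q"
  shows "tensor Es \<in> carrier_mat (q ^ length Es) (q ^ length Es)"
  using assms by (induction Es) (auto simp: tensor_def intro!: carrier_matI)

lemma unitary_nonzero:
  assumes U: "is_unitary q U" and q: "q > 0"
  obtains i j where "i < q" "j < q" "U $$ (i, j) \<noteq> 0"
proof -
  have C: "U \<in> carrier_mat q q" using U by (simp add: is_unitary_def)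
  have "\<exists>i<q. \<exists>j<q. U $$ (i, j) \<noteq> 0"
  proof (rule ccontr)
    assume "\<not> ?thesis"
    then have "U = 0\<^sub>m q q" using C by (intro eq_matI) auto
    have adj: "mat_adjoint U \<in> carrier_mat q q"
      using C by (auto simp: mat_adjoint_def intro!: carrier_matI)
    have "1\<^sub>m q = U * mat_adjoint U"
      using U by (simp add: is_unitary_def)
    also have "\<dots> = 0\<^sub>m q q"
      unfolding \<open>U = 0\<^sub>m q q\<close> using adj[unfolded \<open>U = 0\<^sub>m q q\<close>] by (rule left_mult_zero_mat)
    finally have "(1\<^sub>m q :: cmat) = 0\<^sub>m q q" .
    then have "(1\<^sub>m q :: cmat) $$ (0, 0) = 0\<^sub>m q q $$ (0, 0)" by simp
    then show False using q by simp
  qed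
  then show ?thesis using that by blast
qed

lemma error_basis_proportional:
  assumes \<E>: "error_basis q \<E>" and q: "q > 0" and E: "E \<in> \<E>" and F: "F \<in> \<E>" and EF: "F = c \<cdot>\<^sub>m E"
  shows "E = F"
proof (rule ccontr)
  assume "E \<noteq> F"
  have U: "is_unitary q E" "is_unitary q F" using \<E> E F by (auto simp: error_basis_def)
  then have C: "E \<in> carrier_mat q q" "F \<in> carrier_mat q q" "mat_adjoint E \<in> carrier_mat q q"
    by (auto simp: is_unitary_def mat_adjoint_def intro!: carrier_matI)
  have "F * mat_adjoint E = c \<cdot>\<^sub>m 1\<^sub>m q"
    unfolding EF mult_smult_assoc_mat[OF C(1,3)]
    using U(1) by (simp add: is_unitary_def)
  then have "mtrace (F * mat_adjoint E) = c * of_nat q"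
    by (simp add: mtrace_def)
  moreover have "mtrace (F * mat_adjoint E) = 0"
    using \<E> E F \<open>E \<noteq> F\<close> by (auto simp: error_basis_def)
  ultimately have "c = 0" using q by simp
  obtain i j where "i < q" "j < q" "F $$ (i, j) \<noteq> 0"
    using unitary_nonzero[OF U(2) q] .
  then show False using \<open>c = 0\<close> EF C by simp
qed

lemma tensor_nonzero:
  assumes \<E>: "\<forall>E\<in>\<E>. is_unitary q E" and q: "q > 0" and "set Es \<subseteq> \<E>"
  shows "\<exists>i<q ^ length Es. \<exists>j<q ^ length Es. tensor Es $$ (i, j) \<noteq> 0"
  using assms(3)
proof (induction Es)
  case Nil
  then show ?case by (simp add: tensor_def)
next
  case (Cons E Es)
  then obtain i' j' where 1: "i' < q ^ length Es" "j' < q ^ length Es" "tensor Es $$ (i', j') \<noteq> 0"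
    by auto
  have U: "is_unitary q E" using \<E> Cons.prems by auto
  then obtain i j where 2: "i < q" "j < q" "E $$ (i, j) \<noteq> 0"
    using unitary_nonzero q by blast
  have C: "E \<in> carrier_mat q q" using U by (simp add: is_unitary_def)
  have T: "tensor Es \<in> carrier_mat (q ^ length Es) (q ^ length Es)"
    using \<E> Cons.prems by (intro tensor_carrier) (auto simp: is_unitary_def)
  have "tensor (E # Es) $$ (i * q ^ length Es + i', j * q ^ length Es + j') \<noteq> 0"
    using kron_entry[of i E j i' "tensor Es" j'] 1 2 C T by (simp add: tensor_def)
  moreover have "a * c + b < q * c" if "a < q" "b < c" for a b c :: nat
  proof -
    have "a * c + b < (a + 1) * c" using that(2) by simp
    also have "\<dots> \<le> q * c" using that(1) by (intro mult_right_mono) auto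
    finally show ?thesis .
  qed
  ultimately show ?case
    by (intro exI[of _ "i * q ^ length Es + i'"] exI[of _ "j * q ^ length Es + j'"] conjI)
      (simp_all add: 1 2)
qed

lemma error_basis_tensor_inj:
  assumes \<E>: "error_basis q \<E>" and q: "q > 0"
    and "set Es \<subseteq> \<E>" "set Fs \<subseteq> \<E>" "length Es = length Fs" "tensor Es = tensor Fs"
  shows "Es = Fs"
  using assms(5,3,4,6)
proof (induction Es Fs rule: list_induct2)
  case (Cons E Es F Fs)
  let ?N = "q ^ length Es"
  have U: "\<forall>E\<in>\<E>. is_unitary q E" using \<E> by (simp add: error_basis_def)
  then have car: "\<forall>E\<in>\<E>. E \<in> carrier_mat q q" by (simp add: is_unitary_def)
  have C: "E \<in> carrier_mat q q" "F \<in> carrier_mat q q"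
    using car Cons.prems by auto
  have T: "tensor Es \<in> carrier_mat ?N ?N" "tensor Fs \<in> carrier_mat ?N ?N"
    using tensor_carrier[of Es q] tensor_carrier[of Fs q] car Cons by auto
  have eq: "E $$ (i, j) * tensor Es $$ (i', j') = F $$ (i, j) * tensor Fs $$ (i', j')"
    if "i < q" "j < q" "i' < ?N" "j' < ?N" for i j i' j'
    using kron_entry[of i E j i' "tensor Es" j'] kron_entry[of i F j i' "tensor Fs" j'] that C T
      Cons.prems(3) by (simp add: tensor_def)
  obtain a b where ab: "a < ?N" "b < ?N" "tensor Fs $$ (a, b) \<noteq> 0"
    using tensor_nonzero[OF U q, of Fs] Cons by auto
  have "F = (tensor Es $$ (a, b) / tensor Fs $$ (a, b)) \<cdot>\<^sub>m E"
    using C eq[OF _ _ ab(1,2)] ab(3) by (intro eq_matI) (auto simp: field_simps)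
  then have "E = F"
    using error_basis_proportional[OF \<E> q] Cons.prems by auto
  moreover obtain i j where ij: "i < q" "j < q" "F $$ (i, j) \<noteq> 0"
    using unitary_nonzero[of q F] U q Cons.prems by auto
  ultimately have "tensor Es = tensor Fs"
    using T eq[OF ij(1,2)] by (intro eq_matI) auto
  then show ?case using Cons \<open>E = F\<close> by auto
qed simp

end

theory Submission
  imports Defs
begin

text \<open>An error basis is orthogonal with respect to the trace form, so every operator on the
  \<open>n\<close>-fold tensor product is \<open>q\<^sup>-\<^sup>n\<close> times the sum of its pairings with the tensor
  products \<open>D\<close> of basis elements.  Expanding \<open>M\<^sub>1\<close> in the \<open>D\<close> and \<open>M\<^sub>2\<close> in the adjoints of
  the \<open>D'\<close> turns the coefficients of the \<open>B\<close>-enumerator into products of those of the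
  \<open>A\<close>-enumerator with traces that factor over the legs.  Summed against the weights, the
  factors of the legs outside \<open>J\<close> give \<open>\<Phi>\<close> by hypothesis; the factors of the legs in \<open>J\<close>
  are the matrix entries of \<open>Psi\<close>.\<close>

section \<open>Kronecker products, adjoints and traces\<close>

text \<open>An index of a Kronecker product encodes a pair of indices by quotient and remainder;
  grouping the range into blocks of length \<open>n\<close> separates them. Products and traces of
  Kronecker products reduce to this.\<close>

lemma sum_div_mod:
  fixes f :: "nat \<Rightarrow> nat \<Rightarrow> 'a::comm_monoid_add"
  shows "(\<Sum>k<m * n. f (k div n) (k mod n)) = (\<Sum>x<m. \<Sum>y<n. f x y)"
proof -
  have "(\<Sum>k<m * n. f (k div n) (k mod n)) =
    (\<Sum>x<m. \<Sum>k = x * n..<x * n + n. f (k div n) (k mod n))"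
    by (rule sum.nat_group [symmetric])
  also have "\<dots> = (\<Sum>x<m. \<Sum>y<n. f x y)"
  proof (rule sum.cong [OF refl])
    show "(\<Sum>k = x * n..<x * n + n. f (k div n) (k mod n)) = (\<Sum>y<n. f x y)" for x
      by (rule sum.reindex_bij_witness[of _ "\<lambda>y. x * n + y" "\<lambda>k. k - x * n"])
        (auto simp: div_nat_eqI modulo_nat_def add.commute mult.commute)
  qed
  finally show ?thesis .
qed

lemma dim_mat_adjoint [simp]:
  "dim_row (mat_adjoint A) = dim_col A" "dim_col (mat_adjoint A) = dim_row A"
  by (simp_all add: mat_adjoint_def)

lemma index_mat_adjoint [simp]:
  fixes A :: cmat
  shows "i < dim_col A \<Longrightarrow> j < dim_row A \<Longrightarrow> mat_adjoint A $$ (i, j) = cnj (A $$ (j, i))"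
  by (simp add: mat_adjoint_def mat_of_rows_index)

lemma mat_adjoint_carrier [simp]: "A \<in> carrier_mat m n \<Longrightarrow> mat_adjoint A \<in> carrier_mat n m"
  by auto

lemma index_kron [simp]:
  assumes "i < dim_row A * dim_row B" "j < dim_col A * dim_col B"
  shows "(A \<otimes>\<^sub>k B) $$ (i, j) =
    A $$ (i div dim_row B, j div dim_col B) * B $$ (i mod dim_row B, j mod dim_col B)"
  using assms by (simp add: kron_def)

lemma div_mod_less:
  fixes i m n :: nat
  assumes "i < m * n"
  shows "i div n < m" "i mod n < n"
  using assms by (auto simp: less_mult_imp_div_less intro!: mod_less_divisor Nat.gr0I)

text \<open>The mixed-product rule: the summation index of the matrix product splits into quotient
  and remainder, and the resulting double sum is a product of two sums.\<close>

lemma kron_mult: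
  fixes A B C D :: cmat
  assumes "dim_col A = dim_row C" "dim_col B = dim_row D"
  shows "(A \<otimes>\<^sub>k B) * (C \<otimes>\<^sub>k D) = (A * C) \<otimes>\<^sub>k (B * D)"
proof (rule eq_matI)
  fix i j
  assume "i < dim_row ((A * C) \<otimes>\<^sub>k (B * D))" "j < dim_col ((A * C) \<otimes>\<^sub>k (B * D))"
  then have ij: "i < dim_row A * dim_row B" "j < dim_col C * dim_col D" by simp_all
  let ?f = "\<lambda>x y. A $$ (i div dim_row B, x) * B $$ (i mod dim_row B, y) *
    (C $$ (x, j div dim_col D) * D $$ (y, j mod dim_col D))"
  note lt = div_mod_less[OF ij(1)] div_mod_less[OF ij(2)]
  have "((A \<otimes>\<^sub>k B) * (C \<otimes>\<^sub>k D)) $$ (i, j) =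
    (\<Sum>k<dim_row C * dim_row D. (A \<otimes>\<^sub>k B) $$ (i, k) * (C \<otimes>\<^sub>k D) $$ (k, j))"
    using ij assms by (simp add: scalar_prod_def atLeast0LessThan)
  also have "\<dots> = (\<Sum>k<dim_row C * dim_row D. ?f (k div dim_row D) (k mod dim_row D))"
    using ij assms by (intro sum.cong) auto
  also have "\<dots> = (\<Sum>x<dim_row C. A $$ (i div dim_row B, x) * C $$ (x, j div dim_col D)) *
     (\<Sum>y<dim_row D. B $$ (i mod dim_row B, y) * D $$ (y, j mod dim_col D))"
    unfolding sum_div_mod[of ?f] by (simp add: sum_product mult_ac)
  also have "\<dots> = ((A * C) \<otimes>\<^sub>k (B * D)) $$ (i, j)"
    using ij lt assms by (simp add: scalar_prod_def atLeast0LessThan)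
  finally show "((A \<otimes>\<^sub>k B) * (C \<otimes>\<^sub>k D)) $$ (i, j) = ((A * C) \<otimes>\<^sub>k (B * D)) $$ (i, j)" .
qed simp_all

lemma kron_adjoint: "mat_adjoint (A \<otimes>\<^sub>k B) = mat_adjoint A \<otimes>\<^sub>k mat_adjoint B"
  by (rule eq_matI) (simp_all add: div_mod_less)

lemma mtrace_kron:
  assumes "dim_col A = dim_row A" "dim_col B = dim_row B"
  shows "mtrace (A \<otimes>\<^sub>k B) = mtrace A * mtrace B"
proof -
  let ?f = "\<lambda>x y. A $$ (x, x) * B $$ (y, y)"
  have "mtrace (A \<otimes>\<^sub>k B) =
    (\<Sum>k<dim_row A * dim_row B. ?f (k div dim_row B) (k mod dim_row B))"
    using assms by (simp add: mtrace_def)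
  then show ?thesis
    unfolding sum_div_mod[of ?f] by (simp add: mtrace_def sum_product)
qed

lemma tensor_Nil [simp]: "tensor [] = 1\<^sub>m 1"
  and tensor_Cons [simp]: "tensor (A # As) = A \<otimes>\<^sub>k tensor As"
  by (simp_all add: tensor_def)

text \<open>Adjoints and products act on each tensor factor separately, and the trace is
  multiplicative under Kronecker products. This is what makes the traces factor over the
  legs.\<close>

lemma mtrace_tensor_prod:
  assumes "distinct xs"
    and "\<And>k. k \<in> set xs \<Longrightarrow> F k \<in> carrier_mat q q \<and> D k \<in> carrier_mat q q \<and>
      F' k \<in> carrier_mat q q \<and> D' k \<in> carrier_mat q q"
  shows "mtrace (mat_adjoint (tensor (map F xs)) * tensor (map D xs) * tensor (map F' xs) *
       mat_adjoint (tensor (map D' xs))) =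
    (\<Prod>k\<in>set xs. mtrace (mat_adjoint (F k) * D k * F' k * mat_adjoint (D' k)))"
  using assms
proof (induction xs)
  case Nil
  then show ?case by (simp add: mtrace_def scalar_prod_def)
next
  case (Cons x xs)
  have 1: "dim_row (A x) = q" "dim_col (A x) = q" if "A \<in> {F, D, F', D'}" for A
    using Cons.prems(2)[of x] that by auto
  have 2: "dim_row (tensor (map A xs)) = q ^ length xs" "dim_col (tensor (map A xs)) = q ^ length xs"
    if "A \<in> {F, D, F', D'}" for A
    using tensor_carrier[of "map A xs" q] Cons.prems(2) that by auto
  show ?case
    using Cons 1 2 by (simp add: kron_adjoint kron_mult mtrace_kron)
qed

section \<open>Sums over families indexed by legs\<close>

lemma sum_PiE_insert:
  assumes "x \<notin> S"
  shows "(\<Sum>E\<in>insert x S \<rightarrow>\<^sub>E T. g E) = (\<Sum>e\<in>T. \<Sum>E\<in>S \<rightarrow>\<^sub>E T. g (E(x := e)))"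
  unfolding PiE_insert_eq using inj_combinator[OF assms, of "\<lambda>_. T"]
  by (simp add: sum.reindex case_prod_unfold sum.cartesian_product)

text \<open>A family on a disjoint union amounts to a pair of families, by restriction in one
  direction and gluing in the other.\<close>

lemma sum_PiE_Un:
  assumes "J \<inter> K = {}"
  shows "(\<Sum>E\<in>J \<union> K \<rightarrow>\<^sub>E T. g (restrict E J) (restrict E K)) =
    (\<Sum>F\<in>J \<rightarrow>\<^sub>E T. \<Sum>G\<in>K \<rightarrow>\<^sub>E T. g F G)"
proof -
  have "(\<Sum>E\<in>J \<union> K \<rightarrow>\<^sub>E T. g (restrict E J) (restrict E K)) =
    (\<Sum>(F, G)\<in>(J \<rightarrow>\<^sub>E T) \<times> (K \<rightarrow>\<^sub>E T). g F G)"
    using assms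
    by (intro sum.reindex_bij_witness[of _
          "\<lambda>(F, G) k. if k \<in> J then F k else G k" "\<lambda>E. (restrict E J, restrict E K)"])
      (fastforce simp: PiE_def extensional_def Pi_def restrict_def fun_eq_iff)+
  then show ?thesis by (simp add: sum.cartesian_product)
qed

section \<open>Expansions in a basis of matrices\<close>

text \<open>Translates sums in the abstract matrix module into entries. Membership in the carrier
  belongs to the same induction, because reading off an entry of the next sum requires the
  dimensions of the partial sum.\<close>

lemma finsum_mat:
  assumes "finite A" "f \<in> A \<rightarrow> carrier_mat m n"
  shows "finsum (module_mat TYPE('a::comm_ring_1) m n) f A \<in> carrier_mat m n \<and>
    (\<forall>i<m. \<forall>j<n. finsum (module_mat TYPE('a) m n) f A $$ (i, j) = (\<Sum>x\<in>A. f x $$ (i, j)))"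
  using assms
proof (induction A rule: finite_induct)
  interpret abelian_group "module_mat TYPE('a) m n" by (rule abelian_group_mat)
  case empty
  show ?case unfolding finsum_empty by (simp add: module_mat_simps)
next
  interpret abelian_group "module_mat TYPE('a) m n" by (rule abelian_group_mat)
  case (insert x A)
  have "finsum (module_mat TYPE('a) m n) f (insert x A) =
      f x + finsum (module_mat TYPE('a) m n) f A"
    using insert by (subst finsum_insert) (auto simp: module_mat_simps)
  then show ?case using insert by auto
qed

text \<open>Spanning yields a linear combination over a finite subset. The subset \<open>A\<close>
  stays explicit because the basis is not yet known to be finite.\<close>

lemma basis_expansion:
  assumes \<E>: "vectorspace.basis class_ring (module_mat TYPE('a::field) m n) \<E>"
    and M: "M \<in> carrier_mat m n"
  obtains c A where "finite A" "A \<subseteq> \<E>"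
    "\<And>i j. i < m \<Longrightarrow> j < n \<Longrightarrow> M $$ (i, j) = (\<Sum>E\<in>A. c E * E $$ (i, j))"
proof -
  interpret vectorspace class_ring "module_mat TYPE('a) m n" by (rule matrix_vs)
  have "M \<in> span \<E>" and C: "\<E> \<subseteq> carrier_mat m n"
    using \<E> M by (simp_all add: basis_def module_mat_simps)
  then obtain c A where A: "finite A" "A \<subseteq> \<E>" "M = lincomb c A"
    by (auto simp: span_def)
  have f: "(\<lambda>E. c E \<cdot>\<^sub>m E) \<in> A \<rightarrow> carrier_mat m n" using A C by auto
  have M_eq: "M = finsum (module_mat TYPE('a) m n) (\<lambda>E. c E \<cdot>\<^sub>m E) A"
    using A(3) by (simp add: lincomb_def module_mat_simps)
  have "M $$ (i, j) = (\<Sum>E\<in>A. c E * E $$ (i, j))" if "i < m" "j < n" for i j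
  proof -
    have "M $$ (i, j) = (\<Sum>E\<in>A. (c E \<cdot>\<^sub>m E) $$ (i, j))"
      using finsum_mat[OF A(1) f] that unfolding M_eq by blast
    also have "\<dots> = (\<Sum>E\<in>A. c E * E $$ (i, j))"
      using A(2) C that by (intro sum.cong) auto
    finally show ?thesis .
  qed
  with A show ?thesis using that by blast
qed

section \<open>Orthogonality, finiteness and completeness of error bases\<close>

lemma mtrace_mult:
  assumes "A \<in> carrier_mat m n" "B \<in> carrier_mat n m"
  shows "mtrace (A * B) = (\<Sum>i<m. \<Sum>j<n. A $$ (i, j) * B $$ (j, i))"
  using assms by (auto simp: mtrace_def scalar_prod_def atLeast0LessThan)

lemma error_basis_carrier:
  assumes "error_basis q \<E>" "E \<in> \<E>"
  shows "E \<in> carrier_mat q q"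
  using assms by (auto simp: error_basis_def is_unitary_def)

text \<open>In dimension zero the identity would be the zero vector, which no linearly independent
  set contains.\<close>

lemma error_basis_dim_pos:
  assumes \<E>: "error_basis q \<E>"
  shows "q > 0"
proof (rule ccontr)
  assume "\<not> q > 0"
  then have "0\<^sub>m q q = (1\<^sub>m q :: cmat)" by (intro eq_matI) auto
  then have 0: "0\<^sub>m q q \<in> \<E>" using \<E> by (simp add: error_basis_def)
  interpret vectorspace class_ring "module_mat TYPE(complex) q q" by (rule matrix_vs)
  show False
    using vs_zero_lin_dep[of \<E>] \<E> 0 by (simp add: error_basis_def basis_def module_mat_simps)
qed

lemma error_basis_mtrace:
  assumes \<E>: "error_basis q \<E>" and "E \<in> \<E>" "F \<in> \<E>"
  shows "mtrace (E * mat_adjoint F) = (if E = F then of_nat q else 0)"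
  using assms by (auto simp: error_basis_def is_unitary_def mtrace_def)

text \<open>Pairing the expansion of a matrix unit with \<open>F\<close> reads off an entry of \<open>F\<close>, because the
  basis is orthogonal.  Since only finitely many basis elements occur in the expansions of the
  matrix units, this also shows that the basis is finite.\<close>

lemma matrix_unit_expansion:
  assumes \<E>: "error_basis q \<E>" and cd: "c < q" "d < q"
  shows "\<exists>x A. finite A \<and> A \<subseteq> \<E> \<and>
    (\<forall>a<q. \<forall>b<q. (\<Sum>E\<in>A. x E * E $$ (a, b)) = of_bool (a = c \<and> b = d)) \<and>
    (\<forall>F\<in>\<E>. cnj (F $$ (c, d)) = (if F \<in> A then of_nat q * x F else 0))"
proof -
  let ?M = "mat q q (\<lambda>(a, b). of_bool (a = c \<and> b = d)) :: cmat"
  obtain x A where A: "finite A" "A \<subseteq> \<E>"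
    "\<And>i j. i < q \<Longrightarrow> j < q \<Longrightarrow> ?M $$ (i, j) = (\<Sum>E\<in>A. x E * E $$ (i, j))"
  proof (rule basis_expansion[of q q \<E> ?M])
    show "vectorspace.basis class_ring (module_mat TYPE(complex) q q) \<E>"
      using \<E> by (simp add: error_basis_def)
  qed simp_all
  have 1: "(\<Sum>E\<in>A. x E * E $$ (a, b)) = of_bool (a = c \<and> b = d)" if "a < q" "b < q" for a b
    using A(3)[OF that] that by simp
  have "cnj (F $$ (c, d)) = (if F \<in> A then of_nat q * x F else 0)" if F: "F \<in> \<E>" for F
  proof -
    have CF: "F \<in> carrier_mat q q" using error_basis_carrier[OF \<E> F] .
    have tr: "mtrace (E * mat_adjoint F) = (\<Sum>a<q. \<Sum>b<q. E $$ (a, b) * cnj (F $$ (a, b)))"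
      if "E \<in> A" for E
      using mtrace_mult[of E q q "mat_adjoint F"] error_basis_carrier[OF \<E>, of E] A(2) that CF
      by auto
    \<comment> \<open>The entry is written as a sum against the matrix unit, so that the expansion
      of the unit can be inserted; exchanging the sums then produces traces to which orthogonality
      applies.\<close>
    have "cnj (F $$ (c, d)) = (\<Sum>a<q. if c = a then \<Sum>b<q. if d = b then cnj (F $$ (a, b)) else 0 else 0)"
      using cd by (simp add: sum.delta')
    also have "\<dots> = (\<Sum>a<q. \<Sum>b<q. of_bool (a = c \<and> b = d) * cnj (F $$ (a, b)))"
      by (intro sum.cong refl) (auto simp: if_distrib intro!: sum.cong)
    also have "\<dots> = (\<Sum>a<q. \<Sum>b<q. (\<Sum>E\<in>A. x E * E $$ (a, b)) * cnj (F $$ (a, b)))"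
      by (intro sum.cong refl) (simp add: 1)
    also have "\<dots> = (\<Sum>a<q. \<Sum>b<q. \<Sum>E\<in>A. x E * (E $$ (a, b) * cnj (F $$ (a, b))))"
      by (simp add: sum_distrib_right mult.assoc)
    also have "\<dots> = (\<Sum>a<q. \<Sum>E\<in>A. \<Sum>b<q. x E * (E $$ (a, b) * cnj (F $$ (a, b))))"
      by (intro sum.cong refl sum.swap)
    also have "\<dots> = (\<Sum>E\<in>A. \<Sum>a<q. \<Sum>b<q. x E * (E $$ (a, b) * cnj (F $$ (a, b))))"
      by (rule sum.swap)
    also have "\<dots> = (\<Sum>E\<in>A. x E * mtrace (E * mat_adjoint F))"
      by (intro sum.cong refl) (simp add: tr sum_distrib_left)
    also have "\<dots> = (\<Sum>E\<in>A. if F = E then of_nat q * x F else 0)"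
      using A(2) F by (intro sum.cong refl) (auto simp: error_basis_mtrace[OF \<E>])
    also have "\<dots> = (if F \<in> A then of_nat q * x F else 0)"
      using A(1) by (simp add: sum.delta')
    finally show ?thesis .
  qed
  then show ?thesis using A(1,2) 1 by (intro exI[of _ x] exI[of _ A]) auto
qed

text \<open>A unitary operator has a nonzero entry, so the basis is covered by the finitely many
  sets \<open>?A c d\<close>, each contained in the finite support of the expansion of a matrix
  unit.\<close>

lemma error_basis_finite:
  assumes \<E>: "error_basis q \<E>"
  shows "finite \<E>"
proof -
  let ?A = "\<lambda>c d. {F \<in> \<E>. F $$ (c, d) \<noteq> 0}"
  have "finite (?A c d)" if cd: "c < q" "d < q" for c d
  proof -
    obtain x A where A: "finite A"
      "\<And>F. F \<in> \<E> \<Longrightarrow> cnj (F $$ (c, d)) = (if F \<in> A then of_nat q * x F else 0)"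
      using matrix_unit_expansion[OF \<E> cd] by auto
    have "?A c d \<subseteq> A"
      using A(2) by (force split: if_splits)
    then show ?thesis using A(1) by (rule finite_subset)
  qed
  then have "finite (\<Union>c<q. \<Union>d<q. ?A c d)" by auto
  moreover have "\<E> \<subseteq> (\<Union>c<q. \<Union>d<q. ?A c d)"
  proof
    fix F assume F: "F \<in> \<E>"
    then have "is_unitary q F" using \<E> by (simp add: error_basis_def)
    then obtain i j where "i < q" "j < q" "F $$ (i, j) \<noteq> 0"
      using unitary_nonzero error_basis_dim_pos[OF \<E>] by blast
    then show "F \<in> (\<Union>c<q. \<Union>d<q. ?A c d)" using F by blast
  qed
  ultimately show ?thesis by (rule finite_subset[rotated])
qed

text \<open>The relation dual to orthogonality. The conjugated \<open>(c, d)\<close> entries are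
  \<open>q\<close> times the coefficients of the matrix unit at \<open>(c, d)\<close>, so the sum
  reassembles an entry of that unit.\<close>

lemma error_basis_complete:
  assumes \<E>: "error_basis q \<E>" and "a < q" "b < q" "c < q" "d < q"
  shows "(\<Sum>E\<in>\<E>. E $$ (a, b) * cnj (E $$ (c, d))) = of_nat q * of_bool (a = c \<and> b = d)"
proof -
  obtain x A where A: "finite A" "A \<subseteq> \<E>"
    "\<And>a b. a < q \<Longrightarrow> b < q \<Longrightarrow> (\<Sum>E\<in>A. x E * E $$ (a, b)) = of_bool (a = c \<and> b = d)"
    "\<And>F. F \<in> \<E> \<Longrightarrow> cnj (F $$ (c, d)) = (if F \<in> A then of_nat q * x F else 0)"
    using matrix_unit_expansion[OF \<E> assms(4,5)] by blast
  have "(\<Sum>E\<in>\<E>. E $$ (a, b) * cnj (E $$ (c, d))) =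
      (\<Sum>E\<in>A. E $$ (a, b) * cnj (E $$ (c, d)))"
    using A(2,4) error_basis_finite[OF \<E>] by (intro sum.mono_neutral_right) auto
  also have "\<dots> = of_nat q * (\<Sum>E\<in>A. x E * E $$ (a, b))"
    unfolding sum_distrib_left using A(2,4) by (intro sum.cong refl) auto
  finally show ?thesis using A(3) assms(2,3) by simp
qed

section \<open>Completeness and expansions for tensor products\<close>

lemma tensor_map_carrier:
  assumes \<E>: "error_basis q \<E>" and "E \<in> S \<rightarrow>\<^sub>E \<E>" "set xs \<subseteq> S"
  shows "tensor (map E xs) \<in> carrier_mat (q ^ length xs) (q ^ length xs)"
  using tensor_carrier[of "map E xs" q] error_basis_carrier[OF \<E>] assms(2,3)
  by (auto simp: PiE_iff subset_iff)

text \<open>Splitting off the first leg factors the sum into the relation for a single leg and the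
  induction hypothesis. The four indices are generalized since the latter is applied to their
  remainders.\<close>

lemma tensor_complete:
  assumes \<E>: "error_basis q \<E>" and "distinct xs"
    and "a < q ^ length xs" "b < q ^ length xs" "c < q ^ length xs" "d < q ^ length xs"
  shows "(\<Sum>E\<in>set xs \<rightarrow>\<^sub>E \<E>. tensor (map E xs) $$ (a, b) * cnj (tensor (map E xs) $$ (c, d))) =
    of_nat (q ^ length xs) * of_bool (a = c \<and> b = d)"
  using assms(2-)
proof (induction xs arbitrary: a b c d)
  case Nil
  then show ?case by simp
next
  case (Cons x xs)
  let ?N = "q ^ length xs" and ?T = "\<lambda>E. tensor (map E xs)"
  have x: "x \<notin> set xs" using Cons.prems by simp
  have upd: "map (E(x := e)) xs = map E xs" for E :: "'a \<Rightarrow> cmat" and e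
    using x by (intro map_cong) auto
  \<comment> \<open>Merges the conditions on quotients and remainders into equality of the full
    indices at the end.\<close>
  have eq: "i = j \<longleftrightarrow> i div ?N = j div ?N \<and> i mod ?N = j mod ?N" for i j
    by (metis div_mult_mod_eq)
  note lt = Cons.prems(2-)[unfolded length_Cons power_Suc, THEN div_mod_less(1)]
    Cons.prems(2-)[unfolded length_Cons power_Suc, THEN div_mod_less(2)]
  have entry: "tensor (map (E(x := e)) (x # xs)) $$ (i, j) =
      e $$ (i div ?N, j div ?N) * ?T E $$ (i mod ?N, j mod ?N)"
    if "e \<in> \<E>" "E \<in> set xs \<rightarrow>\<^sub>E \<E>" "i < q ^ length (x # xs)" "j < q ^ length (x # xs)" for E e i j
    using that error_basis_carrier[OF \<E>, of e] tensor_map_carrier[OF \<E> that(2) subset_refl]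
    by (auto simp: upd simp del: map_fun_upd)
  have "(\<Sum>E\<in>set (x # xs) \<rightarrow>\<^sub>E \<E>.
      tensor (map E (x # xs)) $$ (a, b) * cnj (tensor (map E (x # xs)) $$ (c, d))) =
    (\<Sum>e\<in>\<E>. \<Sum>E\<in>set xs \<rightarrow>\<^sub>E \<E>. (e $$ (a div ?N, b div ?N) * cnj (e $$ (c div ?N, d div ?N))) *
      (?T E $$ (a mod ?N, b mod ?N) * cnj (?T E $$ (c mod ?N, d mod ?N))))"
    unfolding list.set(2) sum_PiE_insert[OF x] using Cons.prems(2-)
    by (intro sum.cong refl) (simp only: entry complex_cnj_mult mult_ac)
  also have "\<dots> = (\<Sum>e\<in>\<E>. e $$ (a div ?N, b div ?N) * cnj (e $$ (c div ?N, d div ?N))) *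
    (\<Sum>E\<in>set xs \<rightarrow>\<^sub>E \<E>. ?T E $$ (a mod ?N, b mod ?N) * cnj (?T E $$ (c mod ?N, d mod ?N)))"
    by (simp add: sum_product)
  also have "\<dots> = of_nat q * of_bool (a div ?N = c div ?N \<and> b div ?N = d div ?N) *
      (of_nat ?N * of_bool (a mod ?N = c mod ?N \<and> b mod ?N = d mod ?N))"
    using Cons.prems(1) lt by (simp only: error_basis_complete[OF \<E>] Cons.IH distinct.simps)
  also have "\<dots> = of_nat (q ^ length (x # xs)) * of_bool (a = c \<and> b = d)"
    unfolding eq[of a c] eq[of b d] by (simp add: of_bool_conj)
  finally show ?case .
qed

text \<open>Completeness collapses the sum over all entries of \<open>M\<close> to the one at
  \<open>(a, b)\<close>. Keeping \<open>q ^ n\<close> on the left postpones division to the final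
  trace formula.\<close>

lemma tensor_expansion:
  assumes \<E>: "error_basis q \<E>" and xs: "distinct xs" "length xs = n"
    and M: "M \<in> carrier_mat (q ^ n) (q ^ n)" and ab: "a < q ^ n" "b < q ^ n"
  shows "of_nat (q ^ n) * M $$ (a, b) =
    (\<Sum>D\<in>set xs \<rightarrow>\<^sub>E \<E>. mtrace (mat_adjoint (tensor (map D xs)) * M) * tensor (map D xs) $$ (a, b))"
proof -
  let ?N = "q ^ n" and ?T = "\<lambda>E. tensor (map E xs)" and ?S = "set xs \<rightarrow>\<^sub>E \<E>"
  have tr: "mtrace (mat_adjoint (?T D) * M) = (\<Sum>d<?N. \<Sum>c<?N. cnj (?T D $$ (c, d)) * M $$ (c, d))"
    if "D \<in> ?S" for D
    using tensor_map_carrier[OF \<E> that subset_refl] xs M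
      mtrace_mult[of "mat_adjoint (?T D)" ?N ?N M]
    by auto
  have "(\<Sum>D\<in>?S. mtrace (mat_adjoint (?T D) * M) * ?T D $$ (a, b)) =
    (\<Sum>D\<in>?S. \<Sum>d<?N. \<Sum>c<?N. M $$ (c, d) * (?T D $$ (a, b) * cnj (?T D $$ (c, d))))"
    by (intro sum.cong refl) (simp add: tr sum_distrib_left sum_distrib_right mult_ac)
  also have "\<dots> = (\<Sum>d<?N. \<Sum>D\<in>?S. \<Sum>c<?N. M $$ (c, d) * (?T D $$ (a, b) * cnj (?T D $$ (c, d))))"
    by (rule sum.swap)
  also have "\<dots> = (\<Sum>d<?N. \<Sum>c<?N. \<Sum>D\<in>?S. M $$ (c, d) * (?T D $$ (a, b) * cnj (?T D $$ (c, d))))"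
    by (intro sum.cong refl sum.swap)
  also have "\<dots> = (\<Sum>d<?N. \<Sum>c<?N. M $$ (c, d) * (of_nat ?N * of_bool (a = c \<and> b = d)))"
    using tensor_complete[OF \<E> xs(1), unfolded xs(2)] ab
    by (simp only: sum_distrib_left[symmetric]) (intro sum.cong refl, simp)
  also have "\<dots> = (\<Sum>d<?N. \<Sum>c<?N. if b = d then if a = c then of_nat ?N * M $$ (c, d) else 0 else 0)"
    by (intro sum.cong refl) simp
  also have "\<dots> = (\<Sum>d<?N. if b = d then of_nat ?N * M $$ (a, d) else 0)"
    using ab(1) by (intro sum.cong refl) auto
  also have "\<dots> = of_nat ?N * M $$ (a, b)"
    using ab(2) by simp
  finally show ?thesis by simp
qed

section \<open>Constants as algebraic functions, and linearity of \<open>Psi\<close>\<close>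

text \<open>Carries identities between complex traces into the coefficients of the enumerators,
  which are algebraic functions.\<close>

lemma const_fun_0 [simp]: "const_fun 0 = 0"
  and const_fun_1 [simp]: "const_fun 1 = 1"
  and const_fun_add: "const_fun (a + b) = const_fun a + const_fun b"
  and const_fun_mult: "const_fun (a * b) = const_fun a * const_fun b"
  by (simp_all add: const_fun_def single_add mult_single[of 0 _ 0, simplified, symmetric])

lemma const_fun_sum: "const_fun (sum f A) = (\<Sum>x\<in>A. const_fun (f x))"
  by (induction A rule: infinite_finite_induct) (simp_all add: const_fun_add)

lemma const_fun_prod: "const_fun (prod f A) = (\<Prod>x\<in>A. const_fun (f x))"
  by (induction A rule: infinite_finite_induct) (simp_all add: const_fun_mult)

lemma const_fun_power: "const_fun (a ^ n) = const_fun a ^ n"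
  by (induction n) (simp_all add: const_fun_mult)

lemma single_sum: "Poly_Mapping.single k (sum f A) = (\<Sum>x\<in>A. Poly_Mapping.single k (f x))"
  by (induction A rule: infinite_finite_induct) (simp_all add: single_add)

lemma scale_single: "scale c (Poly_Mapping.single k x) = Poly_Mapping.single k (c * x)"
  by (rule poly_mapping_eqI) (simp add: lookup_single when_def)

lemma Psi_zero: "Psi q \<E> m 0 = 0"
proof -
  have "scale 0 x = 0" for x :: "'a tensor_space"
    by (rule poly_mapping_eqI) simp
  then show ?thesis by (simp add: Psi_def)
qed

lemma Psi_sum: "Psi q \<E> m (sum f A) = (\<Sum>x\<in>A. Psi q \<E> m (f x))"
  by (induction A rule: infinite_finite_induct) (simp_all add: Psi_zero Psi_add)

lemma Psi_single_coeff:
  assumes "finite \<E>" "G \<in> error_tensors \<E> m" "G' \<in> error_tensors \<E> m"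
  shows "Psi q \<E> m (Poly_Mapping.single (G, G') c) = scale c (Psi_basis q \<E> m G G')"
proof -
  have "Psi q \<E> m (Poly_Mapping.single (G, G') c) =
      Psi q \<E> m (scale c (Poly_Mapping.single (G, G') 1))"
    by (simp add: scale_single)
  then show ?thesis by (simp only: Psi_scale Psi_single[OF assms])
qed

section \<open>Error tensors as images of families\<close>

text \<open>\<open>Psi\<close> sums over operators, the enumerators over families of tensor factors;
  this bijection translates between them. Injectivity is the uniqueness of tensor factors taken from
  an error basis.\<close>

lemma bij_betw_error_tensors:
  assumes \<E>: "error_basis q \<E>" and xs: "distinct xs"
  shows "bij_betw (\<lambda>E. tensor (map E xs)) (set xs \<rightarrow>\<^sub>E \<E>) (error_tensors \<E> (length xs))"
  unfolding bij_betw_def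
proof
  show "inj_on (\<lambda>E. tensor (map E xs)) (set xs \<rightarrow>\<^sub>E \<E>)"
  proof (rule inj_onI)
    fix E F assume EF: "E \<in> set xs \<rightarrow>\<^sub>E \<E>" "F \<in> set xs \<rightarrow>\<^sub>E \<E>"
      "tensor (map E xs) = tensor (map F xs)"
    then have "map E xs = map F xs"
      by (intro error_basis_tensor_inj[OF \<E> error_basis_dim_pos[OF \<E>]]) auto
    with EF(1,2) show "E = F" by (intro PiE_ext) auto
  qed
next
  have surj: "\<exists>E\<in>set xs \<rightarrow>\<^sub>E \<E>. map E xs = Es" if Es: "length Es = length xs" "set Es \<subseteq> \<E>" for Es
  proof
    \<comment> \<open>The witness sends \<open>xs ! i\<close> to \<open>Es ! i\<close>, which is
      consistent because \<open>xs\<close> is distinct; the restriction makes it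
      extensional.\<close>
    let ?E = "restrict (\<lambda>k. the (map_of (zip xs Es) k)) (set xs)"
    have nth: "?E (xs ! i) = Es ! i" if "i < length xs" for i
      using that xs Es(1) by (simp add: map_of_zip_nth)
    then show "map ?E xs = Es" using Es(1) by (intro nth_equalityI) simp_all
    show "?E \<in> set xs \<rightarrow>\<^sub>E \<E>"
    proof (rule PiE_I)
      fix k assume "k \<in> set xs"
      then obtain i where "i < length xs" "k = xs ! i" by (auto simp: in_set_conv_nth)
      then have "?E k = Es ! i" and "Es ! i \<in> set Es" using nth Es(1) by auto
      then show "?E k \<in> \<E>" using Es(2) by (metis subset_iff)
    qed simp
  qed
  show "(\<lambda>E. tensor (map E xs)) ` (set xs \<rightarrow>\<^sub>E \<E>) = error_tensors \<E> (length xs)"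
  proof
    show "(\<lambda>E. tensor (map E xs)) ` (set xs \<rightarrow>\<^sub>E \<E>) \<subseteq> error_tensors \<E> (length xs)"
      unfolding error_tensors_def by (auto dest: PiE_mem intro!: exI)
    show "error_tensors \<E> (length xs) \<subseteq> (\<lambda>E. tensor (map E xs)) ` (set xs \<rightarrow>\<^sub>E \<E>)"
    proof
      fix G assume "G \<in> error_tensors \<E> (length xs)"
      then obtain Es where Es: "length Es = length xs" "set Es \<subseteq> \<E>" "G = tensor Es"
        by (auto simp: error_tensors_def)
      then obtain E where "E \<in> set xs \<rightarrow>\<^sub>E \<E>" "map E xs = Es" using surj by blast
      then show "G \<in> (\<lambda>E. tensor (map E xs)) ` (set xs \<rightarrow>\<^sub>E \<E>)"
        using Es(3) by blast
    qed
  qed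
qed

lemma sum_error_tensors:
  assumes "error_basis q \<E>" "distinct xs"
  shows "(\<Sum>G\<in>error_tensors \<E> (length xs). f G) = (\<Sum>E\<in>set xs \<rightarrow>\<^sub>E \<E>. f (tensor (map E xs)))"
  by (rule sum.reindex_bij_betw[OF bij_betw_error_tensors[OF assms], symmetric])

section \<open>Expanding a trace in both operators\<close>

lemma mtrace_comm:
  assumes "A \<in> carrier_mat m n" "B \<in> carrier_mat n m"
  shows "mtrace (A * B) = mtrace (B * A)"
  unfolding mtrace_mult[OF assms] mtrace_mult[OF assms(2,1)]
  by (subst sum.swap) (simp add: mult.commute)

text \<open>The trace is linear in the entries of its right-hand factor, so an entrywise expansion
  suffices and no sum of matrices has to be formed.\<close>

lemma mtrace_mult_expand:
  assumes A: "A \<in> carrier_mat m n" and M: "M \<in> carrier_mat n m"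
    and Y: "\<And>D. D \<in> S \<Longrightarrow> Y D \<in> carrier_mat n m"
    and eq: "\<And>i j. i < n \<Longrightarrow> j < m \<Longrightarrow> x * M $$ (i, j) = (\<Sum>D\<in>S. c D * Y D $$ (i, j))"
  shows "x * mtrace (A * M) = (\<Sum>D\<in>S. c D * mtrace (A * Y D))"
proof -
  have "x * mtrace (A * M) = (\<Sum>i<m. \<Sum>j<n. A $$ (i, j) * (x * M $$ (j, i)))"
    by (simp add: mtrace_mult[OF A M] sum_distrib_left mult_ac)
  also have "\<dots> = (\<Sum>i<m. \<Sum>j<n. \<Sum>D\<in>S. c D * (A $$ (i, j) * Y D $$ (j, i)))"
    by (intro sum.cong refl) (simp add: eq sum_distrib_left mult_ac)
  also have "\<dots> = (\<Sum>i<m. \<Sum>D\<in>S. \<Sum>j<n. c D * (A $$ (i, j) * Y D $$ (j, i)))"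
    by (intro sum.cong refl sum.swap)
  also have "\<dots> = (\<Sum>D\<in>S. \<Sum>i<m. \<Sum>j<n. c D * (A $$ (i, j) * Y D $$ (j, i)))"
    by (rule sum.swap)
  also have "\<dots> = (\<Sum>D\<in>S. c D * mtrace (A * Y D))"
    by (intro sum.cong refl) (simp add: mtrace_mult[OF A Y] sum_distrib_left)
  finally show ?thesis .
qed

text \<open>Expand the adjoint of \<open>M\<close> at \<open>(b, a)\<close> and conjugate. The
  coefficients then have the form in which \<open>M\<^sub>2\<close> enters
  \<open>enum_A\<close>.\<close>

lemma tensor_expansion_adjoint:
  assumes \<E>: "error_basis q \<E>" and xs: "distinct xs" "length xs = n"
    and M: "M \<in> carrier_mat (q ^ n) (q ^ n)" and ab: "a < q ^ n" "b < q ^ n"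
  shows "of_nat (q ^ n) * M $$ (a, b) =
    (\<Sum>D\<in>set xs \<rightarrow>\<^sub>E \<E>. mtrace (tensor (map D xs) * M) * mat_adjoint (tensor (map D xs)) $$ (a, b))"
proof -
  let ?N = "q ^ n" and ?T = "\<lambda>E. tensor (map E xs)" and ?S = "set xs \<rightarrow>\<^sub>E \<E>"
  have T: "?T D \<in> carrier_mat ?N ?N" if "D \<in> ?S" for D
    using tensor_map_carrier[OF \<E> that subset_refl] xs by simp
  have tr: "cnj (mtrace (mat_adjoint (?T D) * mat_adjoint M)) = mtrace (?T D * M)" if "D \<in> ?S" for D
  proof -
    have "cnj (mtrace (mat_adjoint (?T D) * mat_adjoint M)) =
        (\<Sum>i<?N. \<Sum>j<?N. ?T D $$ (j, i) * M $$ (i, j))"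
      using carrier_matD[OF T[OF that]] carrier_matD[OF M]
      by (simp add: mtrace_mult[of _ ?N ?N] T[OF that] M)
    also have "\<dots> = mtrace (?T D * M)"
      unfolding mtrace_mult[OF T[OF that] M] by (rule sum.swap)
    finally show ?thesis .
  qed
  have adj: "mat_adjoint (?T D) $$ (a, b) = cnj (?T D $$ (b, a))" if "D \<in> ?S" for D
    using carrier_matD[OF T[OF that]] ab by simp
  have "cnj (of_nat ?N * mat_adjoint M $$ (b, a)) =
    cnj (\<Sum>D\<in>?S. mtrace (mat_adjoint (?T D) * mat_adjoint M) * ?T D $$ (b, a))"
    using tensor_expansion[OF \<E> xs, of "mat_adjoint M" b a] M ab by simp
  also have "\<dots> = (\<Sum>D\<in>?S. mtrace (?T D * M) * mat_adjoint (?T D) $$ (a, b))"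
    unfolding cnj_sum by (intro sum.cong refl) (simp only: complex_cnj_mult tr adj)
  finally show ?thesis
    using carrier_matD[OF M] ab by simp
qed

text \<open>\<open>M\<^sub>2\<close> is expanded in adjoints and then \<open>M\<^sub>1\<close> in
  the tensors themselves, each at the cost of a factor \<open>1 / q ^ n\<close>. With this choice
  the factor at each leg is the trace in the hypothesis on \<Phi>.\<close>

lemma mtrace_expansion:
  assumes \<E>: "error_basis q \<E>" and xs: "distinct xs" "length xs = n"
    and M: "M\<^sub>1 \<in> carrier_mat (q ^ n) (q ^ n)" "M\<^sub>2 \<in> carrier_mat (q ^ n) (q ^ n)"
    and F: "F \<in> set xs \<rightarrow>\<^sub>E \<E>" "F' \<in> set xs \<rightarrow>\<^sub>E \<E>"
  shows "mtrace (mat_adjoint (tensor (map F xs)) * M\<^sub>1 * tensor (map F' xs) * M\<^sub>2) =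
    1 / of_nat q ^ (2 * n) * (\<Sum>D\<in>set xs \<rightarrow>\<^sub>E \<E>. \<Sum>D'\<in>set xs \<rightarrow>\<^sub>E \<E>.
      mtrace (mat_adjoint (tensor (map D xs)) * M\<^sub>1) * mtrace (tensor (map D' xs) * M\<^sub>2) *
      (\<Prod>k\<in>set xs. mtrace (mat_adjoint (F k) * D k * F' k * mat_adjoint (D' k))))"
proof -
  let ?N = "q ^ n" and ?T = "\<lambda>E. tensor (map E xs)" and ?S = "set xs \<rightarrow>\<^sub>E \<E>"
  let ?A = "mat_adjoint (?T F)" and ?B = "?T F'"
  let ?a = "\<lambda>D. mtrace (mat_adjoint (?T D) * M\<^sub>1)" and ?b = "\<lambda>D. mtrace (?T D * M\<^sub>2)"
  have T: "?T D \<in> carrier_mat ?N ?N" "mat_adjoint (?T D) \<in> carrier_mat ?N ?N" if "D \<in> ?S" for D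
    using tensor_map_carrier[OF \<E> that subset_refl] xs by simp_all
  note mult = mult_carrier_mat[of _ ?N ?N _ ?N]
  note CF = T(2)[OF F(1)] T(1)[OF F(2)]
  \<comment> \<open>\<open>M\<^sub>1\<close> stands inside the product, while
    \<open>mtrace_mult_expand\<close> acts on the last factor. A cyclic rotation moves it to the
    end, and back after the expansion.\<close>
  have cyclic: "mtrace (?A * M * ?B * Y) = mtrace (?B * Y * ?A * M)"
    if "M \<in> carrier_mat ?N ?N" "Y \<in> carrier_mat ?N ?N" for M Y
  proof -
    note C = CF that
    have "mtrace (?A * M * ?B * Y) = mtrace ((?A * M) * (?B * Y))"
      using C by (intro arg_cong[of _ _ mtrace] assoc_mult_mat[of _ ?N ?N _ ?N _ ?N]) (simp_all add: mult)
    also have "\<dots> = mtrace ((?B * Y) * (?A * M))"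
      using C by (intro mtrace_comm[of _ ?N ?N]) (simp_all add: mult)
    also have "\<dots> = mtrace (?B * Y * ?A * M)"
      using C by (intro arg_cong[of _ _ mtrace] assoc_mult_mat[of _ ?N ?N _ ?N _ ?N, symmetric]) (simp_all add: mult)
    finally show ?thesis .
  qed
  have 2: "of_nat ?N * mtrace (?A * M\<^sub>1 * ?B * M\<^sub>2) =
      (\<Sum>D'\<in>?S. ?b D' * mtrace (?A * M\<^sub>1 * ?B * mat_adjoint (?T D')))"
    using tensor_expansion_adjoint[OF \<E> xs M(2)]
    by (intro mtrace_mult_expand[of _ ?N ?N] mult CF M T)
  have 1: "of_nat ?N * mtrace (?A * M\<^sub>1 * ?B * mat_adjoint (?T D')) =
      (\<Sum>D\<in>?S. ?a D * mtrace (?A * ?T D * ?B * mat_adjoint (?T D')))" if D': "D' \<in> ?S" for D'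
  proof -
    have "of_nat ?N * mtrace (?B * mat_adjoint (?T D') * ?A * M\<^sub>1) =
      (\<Sum>D\<in>?S. ?a D * mtrace (?B * mat_adjoint (?T D') * ?A * ?T D))"
      using tensor_expansion[OF \<E> xs M(1)]
      by (intro mtrace_mult_expand[of _ ?N ?N] mult CF M T D')
    then show ?thesis
      unfolding cyclic[OF M(1) T(2)[OF D']] by (simp only: cyclic[OF T(1) T(2)[OF D']] cong: sum.cong)
  qed
  have prod: "mtrace (?A * ?T D * ?B * mat_adjoint (?T D')) =
      (\<Prod>k\<in>set xs. mtrace (mat_adjoint (F k) * D k * F' k * mat_adjoint (D' k)))"
    if "D \<in> ?S" "D' \<in> ?S" for D D'
    by (intro mtrace_tensor_prod[of _ _ q] xs conjI error_basis_carrier[OF \<E>]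
        PiE_mem[OF F(1)] PiE_mem[OF F(2)] PiE_mem[OF that(1)] PiE_mem[OF that(2)])
  have "of_nat ?N * (of_nat ?N * mtrace (?A * M\<^sub>1 * ?B * M\<^sub>2)) =
    (\<Sum>D'\<in>?S. ?b D' * (of_nat ?N * mtrace (?A * M\<^sub>1 * ?B * mat_adjoint (?T D'))))"
    unfolding 2 by (simp add: sum_distrib_left mult_ac)
  also have "\<dots> = (\<Sum>D'\<in>?S. \<Sum>D\<in>?S. ?a D * ?b D' *
      (\<Prod>k\<in>set xs. mtrace (mat_adjoint (F k) * D k * F' k * mat_adjoint (D' k))))"
    by (intro sum.cong refl) (simp only: 1 prod sum_distrib_left mult_ac cong: sum.cong)
  also have "\<dots> = (\<Sum>D\<in>?S. \<Sum>D'\<in>?S. ?a D * ?b D' *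
      (\<Prod>k\<in>set xs. mtrace (mat_adjoint (F k) * D k * F' k * mat_adjoint (D' k))))"
    by (rule sum.swap)
  finally have eq: "of_nat ?N * (of_nat ?N * mtrace (?A * M\<^sub>1 * ?B * M\<^sub>2)) = \<dots>" .
  have N: "of_nat ?N * of_nat ?N = (of_nat q ^ (2 * n) :: complex)"
    by (simp add: mult_2 power_add)
  show ?thesis
    unfolding eq[symmetric] mult.assoc[symmetric, of "of_nat ?N"] N
    using error_basis_dim_pos[OF \<E>] by simp
qed

section \<open>The transform of a single symbol\<close>

lemma prod_sum_sum_PiE:
  fixes f :: "'a \<Rightarrow> 'b \<Rightarrow> 'b \<Rightarrow> 'c::comm_semiring_1"
  assumes "finite K" "finite T"
  shows "(\<Prod>k\<in>K. \<Sum>x\<in>T. \<Sum>y\<in>T. f k x y) =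
    (\<Sum>G\<in>K \<rightarrow>\<^sub>E T. \<Sum>G'\<in>K \<rightarrow>\<^sub>E T. \<Prod>k\<in>K. f k (G k) (G' k))"
  using assms by (simp add: prod_sum_PiE)

text \<open>The two families are split one after the other and the sums reordered. The outer sums
  over \<open>F\<close> and \<open>F'\<close> will index symbols, the inner ones over
  \<open>G\<close> and \<open>G'\<close> their coefficients.\<close>

lemma sum_PiE_Un2:
  assumes "J \<inter> K = {}"
  shows "(\<Sum>E\<in>J \<union> K \<rightarrow>\<^sub>E T. \<Sum>E'\<in>J \<union> K \<rightarrow>\<^sub>E T.
      h (restrict E J) (restrict E' J) (restrict E K) (restrict E' K)) =
    (\<Sum>F\<in>J \<rightarrow>\<^sub>E T. \<Sum>F'\<in>J \<rightarrow>\<^sub>E T. \<Sum>G\<in>K \<rightarrow>\<^sub>E T. \<Sum>G'\<in>K \<rightarrow>\<^sub>E T. h F F' G G')"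
proof -
  let ?P = "\<lambda>I. I \<rightarrow>\<^sub>E T"
  have "(\<Sum>E\<in>?P (J \<union> K). \<Sum>E'\<in>?P (J \<union> K).
      h (restrict E J) (restrict E' J) (restrict E K) (restrict E' K)) =
    (\<Sum>E\<in>?P (J \<union> K). \<Sum>F'\<in>?P J. \<Sum>G'\<in>?P K. h (restrict E J) F' (restrict E K) G')"
    by (intro sum.cong refl sum_PiE_Un[OF assms])
  also have "\<dots> = (\<Sum>F\<in>?P J. \<Sum>G\<in>?P K. \<Sum>F'\<in>?P J. \<Sum>G'\<in>?P K. h F F' G G')"
    by (rule sum_PiE_Un[OF assms])
  also have "\<dots> = (\<Sum>F\<in>?P J. \<Sum>F'\<in>?P J. \<Sum>G\<in>?P K. \<Sum>G'\<in>?P K. h F F' G G')"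
    by (intro sum.cong refl sum.swap)
  finally show ?thesis .
qed

text \<open>The hypothesis on \<Phi> gives a sum over pairs at each leg in \<open>K\<close>, and
  \<open>Psi_basis\<close> supplies the pairs on \<open>js\<close>; gluing them gives pairs of
  families on all legs. The arbitrary \<open>\<gamma>\<close> later holds the traces with
  \<open>M\<^sub>1\<close> and \<open>M\<^sub>2\<close>.\<close>

lemma scale_Psi_basis_eq_sum:
  fixes wt :: "('k::{finite,linorder}) weight" and \<Phi> :: "'k \<Rightarrow> 'k algfun"
  assumes \<E>: "error_basis q \<E>" and js: "distinct js" and fin: "finite K" and disj: "set js \<inter> K = {}"
    and wt: "\<And>D D'. D \<in> \<E> \<Longrightarrow> D' \<in> \<E> \<Longrightarrow> vpow \<Phi> (wt D D') =
      const_fun (1 / of_nat q ^ 2) *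
      (\<Sum>E\<in>\<E>. \<Sum>E'\<in>\<E>.
        const_fun (mtrace (mat_adjoint E * D * E' * mat_adjoint D')) * vpow indet (wt E E'))"
    and D: "D \<in> set js \<union> K \<rightarrow>\<^sub>E \<E>" "D' \<in> set js \<union> K \<rightarrow>\<^sub>E \<E>"
  shows "scale (\<gamma> * (\<Prod>k\<in>K. vpow \<Phi> (wt (D k) (D' k))))
      (Psi_basis q \<E> (length js) (tensor (map D js)) (tensor (map D' js))) =
    (\<Sum>H\<in>set js \<union> K \<rightarrow>\<^sub>E \<E>. \<Sum>H'\<in>set js \<union> K \<rightarrow>\<^sub>E \<E>.
      Poly_Mapping.single (tensor (map H js), tensor (map H' js))
        (const_fun (1 / of_nat q ^ (2 * (length js + card K))) * \<gamma> *
          (\<Prod>k\<in>set js \<union> K. const_fun (mtrace (mat_adjoint (H k) * D k * H' k * mat_adjoint (D' k)))) *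
          (\<Prod>k\<in>K. vpow indet (wt (H k) (H' k)))))"
proof -
  let ?t = "\<lambda>k E E'. const_fun (mtrace (mat_adjoint E * D k * E' * mat_adjoint (D' k))) :: 'k algfun"
  let ?P = "\<lambda>I. I \<rightarrow>\<^sub>E \<E>" and ?T = "\<lambda>E. tensor (map E js)"
  let ?c = "\<lambda>j. const_fun (1 / of_nat q ^ (2 * j)) :: 'k algfun"
  \<comment> \<open>The symbol depends on the families over \<open>js\<close>, the weights on those
    over \<open>K\<close>. Keeping all four as separate arguments is the form that
    \<open>sum_PiE_Un2\<close> requires.\<close>
  define h where "h F F' G G' = Poly_Mapping.single (?T F, ?T F')
    (?c (length js + card K) * \<gamma> * (\<Prod>k\<in>set js. ?t k (F k) (F' k)) *
      (\<Prod>k\<in>K. ?t k (G k) (G' k) * vpow indet (wt (G k) (G' k))))" for F F' G G'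
  have c_add: "?c (i + j) = ?c i * ?c j" for i j
    by (simp add: const_fun_mult[symmetric] distrib_left power_add)
  have \<Phi>_prod: "(\<Prod>k\<in>K. vpow \<Phi> (wt (D k) (D' k))) = ?c (card K) *
    (\<Sum>G\<in>?P K. \<Sum>G'\<in>?P K. \<Prod>k\<in>K. ?t k (G k) (G' k) * vpow indet (wt (G k) (G' k)))"
  proof -
    have "(\<Prod>k\<in>K. vpow \<Phi> (wt (D k) (D' k))) = (\<Prod>k\<in>K. const_fun (1 / of_nat q ^ 2) *
      (\<Sum>E\<in>\<E>. \<Sum>E'\<in>\<E>. ?t k E E' * vpow indet (wt E E')))"
      using D by (intro prod.cong refl wt) (blast dest: PiE_mem)+
    also have "\<dots> = const_fun (1 / of_nat q ^ 2) ^ card K *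
      (\<Prod>k\<in>K. \<Sum>E\<in>\<E>. \<Sum>E'\<in>\<E>. ?t k E E' * vpow indet (wt E E'))"
      by (simp add: prod.distrib)
    also have "const_fun (1 / of_nat q ^ 2) ^ card K = ?c (card K)"
      by (simp add: const_fun_power[symmetric] power_divide power_mult)
    finally show ?thesis
      by (simp only: prod_sum_sum_PiE[OF fin error_basis_finite[OF \<E>]])
  qed
  have trace_prod: "const_fun (mtrace (mat_adjoint (?T F) * ?T D * ?T F' * mat_adjoint (?T D'))) =
    (\<Prod>k\<in>set js. ?t k (F k) (F' k))" if F: "F \<in> ?P (set js)" "F' \<in> ?P (set js)" for F F'
    unfolding const_fun_prod[symmetric]
    by (intro arg_cong[of _ _ const_fun] mtrace_tensor_prod[of _ _ q] js conjI error_basis_carrier[OF \<E>]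
        PiE_mem[OF F(1)] PiE_mem[OF F(2)] PiE_mem[OF D(1)] PiE_mem[OF D(2)] UnI1)
  have "scale (\<gamma> * (\<Prod>k\<in>K. vpow \<Phi> (wt (D k) (D' k)))) (Psi_basis q \<E> (length js) (?T D) (?T D')) =
    (\<Sum>F\<in>?P (set js). \<Sum>F'\<in>?P (set js). Poly_Mapping.single (?T F, ?T F')
      (\<gamma> * (\<Prod>k\<in>K. vpow \<Phi> (wt (D k) (D' k))) * (?c (length js) *
        const_fun (mtrace (mat_adjoint (?T F) * ?T D * ?T F' * mat_adjoint (?T D'))))))"
    by (simp only: Psi_basis_def sum_error_tensors[OF \<E> js] scale_sum scale_single mult.assoc)
  also have "\<dots> = (\<Sum>F\<in>?P (set js). \<Sum>F'\<in>?P (set js). \<Sum>G\<in>?P K. \<Sum>G'\<in>?P K. h F F' G G')"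
  proof (intro sum.cong refl)
    fix F F' assume F: "F \<in> ?P (set js)" "F' \<in> ?P (set js)"
    have "\<gamma> * (\<Prod>k\<in>K. vpow \<Phi> (wt (D k) (D' k))) * (?c (length js) *
        const_fun (mtrace (mat_adjoint (?T F) * ?T D * ?T F' * mat_adjoint (?T D')))) =
      ?c (length js + card K) * \<gamma> * (\<Prod>k\<in>set js. ?t k (F k) (F' k)) *
      (\<Sum>G\<in>?P K. \<Sum>G'\<in>?P K. \<Prod>k\<in>K. ?t k (G k) (G' k) * vpow indet (wt (G k) (G' k)))"
      unfolding \<Phi>_prod trace_prod[OF F] c_add by (simp only: mult_ac)
    then show "Poly_Mapping.single (?T F, ?T F')
        (\<gamma> * (\<Prod>k\<in>K. vpow \<Phi> (wt (D k) (D' k))) * (?c (length js) *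
          const_fun (mtrace (mat_adjoint (?T F) * ?T D * ?T F' * mat_adjoint (?T D'))))) =
      (\<Sum>G\<in>?P K. \<Sum>G'\<in>?P K. h F F' G G')"
      by (simp only: h_def single_sum sum_distrib_left)
  qed
  also have "\<dots> = (\<Sum>H\<in>?P (set js \<union> K). \<Sum>H'\<in>?P (set js \<union> K).
      h (restrict H (set js)) (restrict H' (set js)) (restrict H K) (restrict H' K))"
    by (rule sum_PiE_Un2[OF disj, symmetric])
  also have "\<dots> = (\<Sum>H\<in>?P (set js \<union> K). \<Sum>H'\<in>?P (set js \<union> K).
      Poly_Mapping.single (?T H, ?T H') (?c (length js + card K) * \<gamma> *
        (\<Prod>k\<in>set js \<union> K. ?t k (H k) (H' k)) * (\<Prod>k\<in>K. vpow indet (wt (H k) (H' k)))))"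
  proof (intro sum.cong refl)
    fix H H'
    \<comment> \<open>The symbol reads only the values on \<open>js\<close>, so restriction does not
      change it.\<close>
    have T: "?T (restrict E (set js)) = ?T E" for E by (simp cong: map_cong)
    have "(\<Prod>k\<in>set js \<union> K. ?t k (H k) (H' k)) =
        (\<Prod>k\<in>set js. ?t k (H k) (H' k)) * (\<Prod>k\<in>K. ?t k (H k) (H' k))"
      using fin disj by (intro prod.union_disjoint) simp_all
    then show "h (restrict H (set js)) (restrict H' (set js)) (restrict H K) (restrict H' K) =
      Poly_Mapping.single (?T H, ?T H') (?c (length js + card K) * \<gamma> *
        (\<Prod>k\<in>set js \<union> K. ?t k (H k) (H' k)) * (\<Prod>k\<in>K. vpow indet (wt (H k) (H' k))))"
      by (simp add: h_def T prod.distrib mult.assoc)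
  qed
  finally show ?thesis .
qed

section \<open>The MacWilliams identity for tensor enumerators\<close>

theorem mainTheorem5:
  fixes q n :: nat
    and \<E> :: "cmat set"
    and wt :: "('k::{finite,linorder}) weight"
    and \<Phi> :: "'k \<Rightarrow> 'k algfun"
    and J :: "nat set" and js :: "nat list"
    and M\<^sub>1 M\<^sub>2 :: cmat
  assumes "error_basis q \<E>"
    and "scalar_weight \<E> wt"
    and "\<forall>D\<in>\<E>. \<forall>D'\<in>\<E>. vpow \<Phi> (wt D D') =
           const_fun (1 / of_nat q ^ 2) *
           (\<Sum>E\<in>\<E>. \<Sum>E'\<in>\<E>.
              const_fun (mtrace (mat_adjoint E * D * E' * mat_adjoint D')) * vpow indet (wt E E'))"
    and "J \<subseteq> {1..n}" and "set js = J" and "distinct js"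
    and "is_hermitian (q ^ n) M\<^sub>1" and "is_hermitian (q ^ n) M\<^sub>2"
  shows "enum_B \<E> n js wt indet M\<^sub>1 M\<^sub>2 =
         Psi q \<E> (length js) (enum_A \<E> n js wt \<Phi> M\<^sub>1 M\<^sub>2)"
proof -
  note \<E> = assms(1) and js = assms(6)
  define xs where "xs = [1..<Suc n]"
  define K where "K = {1..n} - set js"
  have xs: "distinct xs" "length xs = n" and set_xs: "set xs = {1..n}"
    by (auto simp: xs_def)
  have K: "finite K" "set js \<inter> K = {}" and S: "{1..n} = set js \<union> K"
    using assms(4,5) by (auto simp: K_def)
  \<comment> \<open>Matches the constant from expanding both operators with the one collected from
    \<open>Psi\<close> on \<open>js\<close> and from \<Phi> on \<open>K\<close>.\<close>
  have n: "n = length js + card K"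
    using K card_Un_disjoint[of "set js" K] distinct_card[OF js] S
    by (metis List.finite_set card_atLeastAtMost diff_Suc_1)
  have M: "M\<^sub>1 \<in> carrier_mat (q ^ n) (q ^ n)" "M\<^sub>2 \<in> carrier_mat (q ^ n) (q ^ n)"
    using assms(7,8) by (simp_all add: is_hermitian_def)
  let ?S = "{1..n} \<rightarrow>\<^sub>E \<E>"
  let ?T = "\<lambda>E. tensor (map E xs)" and ?U = "\<lambda>E. tensor (map E js)"
  let ?t = "\<lambda>F D F' D' k. mtrace (mat_adjoint (F k) * D k * F' k * mat_adjoint (D' k))"
  define a b where "a D = mtrace (mat_adjoint (?T D) * M\<^sub>1)" and "b D = mtrace (?T D * M\<^sub>2)" for D
  define \<gamma> where "\<gamma> D D' = (const_fun (a D) * const_fun (b D') :: 'k algfun)" for D D'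
  \<comment> \<open>The common summand: summed over \<open>D\<close>, \<open>D'\<close> it gives a
    term of the \<open>B\<close>-enumerator, summed over \<open>F\<close>, \<open>F'\<close> the
    image under \<open>Psi\<close> of a term of the \<open>A\<close>-enumerator.\<close>
  define g where "g D D' F F' = Poly_Mapping.single (?U F, ?U F')
    (const_fun (1 / of_nat q ^ (2 * n)) * \<gamma> D D' * (\<Prod>k\<in>{1..n}. const_fun (?t F D F' D' k)) *
      (\<Prod>k\<in>K. vpow indet (wt (F k) (F' k))))" for D D' F F'
  have U: "?U E \<in> error_tensors \<E> (length js)" if "E \<in> ?S" for E
  proof -
    have "set (map E js) \<subseteq> \<E>" unfolding set_map using that[unfolded S] by (blast dest: PiE_mem)
    then show ?thesis unfolding error_tensors_def by (blast intro: length_map)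
  qed
  have "enum_B \<E> n js wt indet M\<^sub>1 M\<^sub>2 = (\<Sum>F\<in>?S. \<Sum>F'\<in>?S. \<Sum>D\<in>?S. \<Sum>D'\<in>?S. g D D' F F')"
    unfolding enum_B_def K_def[symmetric] xs_def[symmetric]
  proof (intro sum.cong refl)
    fix F F' assume F: "F \<in> ?S" "F' \<in> ?S"
    have "mtrace (mat_adjoint (?T F) * M\<^sub>1 * ?T F' * M\<^sub>2) = 1 / of_nat q ^ (2 * n) *
        (\<Sum>D\<in>?S. \<Sum>D'\<in>?S. a D * b D' * (\<Prod>k\<in>{1..n}. ?t F D F' D' k))"
      using mtrace_expansion[OF \<E> xs M, unfolded set_xs, OF F] by (simp only: a_def b_def)
    then show "Poly_Mapping.single (?U F, ?U F')
        (const_fun (mtrace (mat_adjoint (?T F) * M\<^sub>1 * ?T F' * M\<^sub>2)) *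
          (\<Prod>k\<in>K. vpow indet (wt (F k) (F' k)))) = (\<Sum>D\<in>?S. \<Sum>D'\<in>?S. g D D' F F')"
      by (simp only: g_def \<gamma>_def const_fun_mult const_fun_sum const_fun_prod single_sum[symmetric]
          sum_distrib_left sum_distrib_right mult.assoc)
  qed
  \<comment> \<open>Adjacent exchanges bring \<open>D\<close> and \<open>D'\<close> to the
    outside.\<close>
  also have "\<dots> = (\<Sum>F\<in>?S. \<Sum>D\<in>?S. \<Sum>F'\<in>?S. \<Sum>D'\<in>?S. g D D' F F')"
    by (intro sum.cong refl sum.swap)
  also have "\<dots> = (\<Sum>D\<in>?S. \<Sum>F\<in>?S. \<Sum>F'\<in>?S. \<Sum>D'\<in>?S. g D D' F F')"
    by (rule sum.swap)
  also have "\<dots> = (\<Sum>D\<in>?S. \<Sum>F\<in>?S. \<Sum>D'\<in>?S. \<Sum>F'\<in>?S. g D D' F F')"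
    by (intro sum.cong refl sum.swap)
  also have "\<dots> = (\<Sum>D\<in>?S. \<Sum>D'\<in>?S. \<Sum>F\<in>?S. \<Sum>F'\<in>?S. g D D' F F')"
    by (intro sum.cong refl sum.swap)
  \<comment> \<open>For fixed \<open>D\<close>, \<open>D'\<close> the sum over \<open>F\<close>,
    \<open>F'\<close> is the transformed symbol of that pair, with the weights now evaluated at
    \<Phi>; linearity of \<open>Psi\<close> then finishes.\<close>
  also have "\<dots> = (\<Sum>D\<in>?S. \<Sum>D'\<in>?S. scale (\<gamma> D D' * (\<Prod>k\<in>K. vpow \<Phi> (wt (D k) (D' k))))
      (Psi_basis q \<E> (length js) (?U D) (?U D')))"
  proof (intro sum.cong refl)
    fix D D' assume "D \<in> ?S" "D' \<in> ?S"
    then show "(\<Sum>F\<in>?S. \<Sum>F'\<in>?S. g D D' F F') =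
        scale (\<gamma> D D' * (\<Prod>k\<in>K. vpow \<Phi> (wt (D k) (D' k)))) (Psi_basis q \<E> (length js) (?U D) (?U D'))"
      using scale_Psi_basis_eq_sum[OF \<E> js K assms(3)[rule_format], of D D' "\<gamma> D D'",
          folded S n]
      by (simp only: g_def)
  qed
  also have "\<dots> = Psi q \<E> (length js) (enum_A \<E> n js wt \<Phi> M\<^sub>1 M\<^sub>2)"
    unfolding enum_A_def Psi_sum K_def[symmetric] xs_def[symmetric]
    by (intro sum.cong refl)
      (simp only: Psi_single_coeff[OF error_basis_finite[OF \<E>] U U] \<gamma>_def a_def b_def)
  finally show ?thesis .
qed

end
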